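(* Let $\mathbb{K}$ be a field of characteristic $0$, let $n\ge0$, $m\ge1$, $d_1\ge1$, $d_2\ge2$ be integers, and let $$f=\sum_{r=0}^n x_r^{d_1}g_r\in S_{(d_1,d_2)},\qquad g_r=u_1^{e_{r,1}}\cdots u_m^{e_{r,m}},\quad e_{r,1}+\dots+e_{r,m}=d_2,$$ be a CW-Nagata polynomial (so $g_0,\dots,g_n$ are pairwise distinct monic monomials of degree $d_2$ in $u_1,\dots,u_m$) with associated CW-complex $\Delta_f$. Then the ideal $I=\mathrm{Ann}(f)\subset T$ is generated by: 1. $X_iX_j$ and $X_k^{d_1+1}$, for $i,j,k\in\{0,\dots,n\}$, $i<j$; 2. all monic monomials of degree $d_2+1$ in $U_1,\dots,U_m$; 3. the monomials $U_1^{s_1}\cdots U_m^{s_m}$ with $s_1+\dots+s_m=j$, $j\in\{1,\dots,d_2\}$, such that $X_{u_1^{s_1}\cdots u_m^{s_m}}$ is a (minimal) element of the $(j-1)$-skeleton of $P(m)$ not contained in $\Delta_f$ (i.e. $u_1^{s_1}\cdots u_m^{s_m}$ is minimal with respect to divisibility among the monomials dividing none of $g_0,\dots,g_n$); 4. the monomials $X_rU_i$, where $u_i$ does not divide $g_r$; 5. the monomials $X_sU_1^{r_1}\cdots U_m^{r_m}$ with $r_1+\dots+r_m=j$, $j\in\{1,\dots,d_2\}$, where $u_1^{r_1}\cdots u_m^{r_m}$ is minimal (with respect to divisibility) among the monomials that do not divide $g_s$ (i.e. $X_{u_1^{r_1}\cdots u_m^{r_m}}$ is a minimal element of the $(j-1)$-skeleton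 of $P(m)$ not contained in $X_{g_s}$); 6. the binomials $X_r^{d_1}U_1^{\rho_1}\cdots U_m^{\rho_m}-X_s^{d_1}U_1^{\sigma_1}\cdots U_m^{\sigma_m}$, with $\rho_1+\dots+\rho_m=\sigma_1+\dots+\sigma_m=j$, such that, setting $g_{r,s}=\gcd(g_r,g_s)$, one has $g_r=u_1^{\rho_1}\cdots u_m^{\rho_m}\,g_{r,s}$ and $g_s=u_1^{\sigma_1}\cdots u_m^{\sigma_m}\,g_{r,s}$ (i.e. $X_{g_{r,s}}=X_{g_r}\cap X_{g_s}$ is the element of the $(d_2-j-1)$-skeleton of $\Delta_f$ representing the intersection).
   Context: $S=\mathbb{K}[x_0,\dots,x_n,u_1,\dots,u_m]$ is bigraded with $\deg x_i=(1,0)$, $\deg u_j=(0,1)$, and $T=\mathbb{K}[X_0,\dots,X_n,U_1,\dots,U_m]$ is the dual bigraded ring of operators on $S$. Convention on the action: the monomial bases of $S_{(a,b)}$ and $T_{(a,b)}$ are dual to each other, that is, $T$ acts on $S$ by normalized differentiation (contraction): a monomial operator $X^{\alpha}U^{\beta}$ sends $x^{\gamma}u^{\delta}$ to $x^{\gamma-\alpha}u^{\delta-\beta}$ if $\alpha\le\gamma$ and $\beta\le\delta$ componentwise, and to $0$ otherwise, extended bilinearly. $\mathrm{Ann}(f)=\{\alpha\in T\mid\alpha(f)=0\}$. A CW-Nagata polynomial of degree $d_1\ge1$ is $f=\sum_{i=0}^n x_i^{d_1}g_i\in S_{(d_1,d_2)}$ where the $g_i\in\mathbb{K}[u_1,\dots,u_m]$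 are linearly independent monomials of degree $d_2\ge 2$. The CW-complex $P(m)$: to each monic monomial $g=u_1^{j_1}\cdots u_m^{j_m}$ of degree $d\ge1$ one associates a $(d-1)$-dimensional finite CW-complex $X_g$, the quotient of the $(d-1)$-simplex with vertex set $\{u_k^{1},\dots,u_k^{j_k}\mid k=1,\dots,m\}$ obtained by identifying, in increasing dimension, faces involving the same number of copies of each variable $u_k$. Thus the cells of $X_g$ of dimension $j-1$ correspond to the monic monomials of degree $j$ dividing $g$, and $X_h\subset X_g$ if and only if $h$ divides $g$. The $X_g$ are glued along their common subcomplexes to form $P(m)$; the elements of the $(d-1)$-skeleton of $P(m)$ are the $X_g$ with $\deg g=d$. The complex $\Delta_f\subset P(m)$ associated to $f$ is the union of the $X_{g_r}$, $r=0,\dots,n$; hence $X_h\subset\Delta_f$ if and only if $h$ divides some $g_r$. (If $\gcd(g_r,g_s)=1$, the intersection $X_{g_r}\cap X_{g_s}$ is empty.) *)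

theory Defs
  imports Complex_Main "HOL-Library.Poly_Mapping"
begin

text \<open>
  The index types \<open>'n\<close> and \<open>'m\<close> stand for \<open>{0..n}\<close> and \<open>{1..m}\<close>.  An exponent of a monomial of
  \<open>S = K[x\<^sub>0,\<dots>,x\<^sub>n,u\<^sub>1,\<dots>,u\<^sub>m]\<close> is a finitely supported function on \<open>'n + 'm\<close>, with \<open>Inl i\<close>
  indexing \<open>x\<^sub>i\<close> and \<open>Inr j\<close> indexing \<open>u\<^sub>j\<close>.  The dual ring \<open>T = K[X\<^sub>0,\<dots>,X\<^sub>n,U\<^sub>1,\<dots>,U\<^sub>m]\<close> has the same
  underlying ring; it is distinguished from \<open>S\<close> by its role in \<open>contract\<close>.
\<close>

type_synonym ('n, 'm) expo = "('n + 'm) \<Rightarrow>\<^sub>0 nat"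
type_synonym ('n, 'm, 'k) S_poly = "('n, 'm) expo \<Rightarrow>\<^sub>0 'k"
type_synonym ('n, 'm, 'k) T_poly = "('n, 'm) expo \<Rightarrow>\<^sub>0 'k"

definition xvar :: "'n \<Rightarrow> ('n, 'm, 'k::comm_ring_1) S_poly" where
  "xvar i = Poly_Mapping.single (Poly_Mapping.single (Inl i) 1) 1"

definition uvar :: "'m \<Rightarrow> ('n, 'm, 'k::comm_ring_1) S_poly" where
  "uvar j = Poly_Mapping.single (Poly_Mapping.single (Inr j) 1) 1"

text \<open>
  Monic monomials in the \<open>u\<^sub>j\<close> alone are given by exponent vectors \<open>e :: 'm \<Rightarrow> nat\<close>.  Divisibility of
  such monomials is the pointwise order on these vectors, and their gcd is the pointwise minimum,
  that is \<open>inf\<close>.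
\<close>

definition umon :: "('m::finite \<Rightarrow> nat) \<Rightarrow> ('n, 'm, 'k::comm_ring_1) S_poly" where
  "umon e = (\<Prod>j\<in>UNIV. uvar j ^ e j)"

definition udeg :: "('m::finite \<Rightarrow> nat) \<Rightarrow> nat" where
  "udeg e = (\<Sum>j\<in>UNIV. e j)"

text \<open>
  The order \<open>\<le>\<close> that the library puts on \<open>\<Rightarrow>\<^sub>0\<close> is lexicographic, so the componentwise comparison
  of exponents is written out.
\<close>

definition contract ::
    "('n, 'm, 'k::comm_ring_1) T_poly \<Rightarrow> ('n, 'm, 'k) S_poly \<Rightarrow> ('n, 'm, 'k) S_poly" where
  "contract a f =
     (\<Sum>s\<in>Poly_Mapping.keys a. \<Sum>t\<in>Poly_Mapping.keys f.
        if \<forall>v. Poly_Mapping.lookup s v \<le> Poly_Mapping.lookup t v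
        then Poly_Mapping.single (t - s) (Poly_Mapping.lookup a s * Poly_Mapping.lookup f t)
        else 0)"

definition Ann :: "('n, 'm, 'k::comm_ring_1) S_poly \<Rightarrow> ('n, 'm, 'k) T_poly set" where
  "Ann f = {a. contract a f = 0}"

lemma module_times: "module ((*) :: 'a::comm_ring_1 \<Rightarrow> 'a \<Rightarrow> 'a)"
  by standard (simp_all add: algebra_simps)

definition ideal_generated :: "'a::comm_ring_1 set \<Rightarrow> 'a set" where
  "ideal_generated G = module.span (*) G"

definition lin_indep :: "('n::finite \<Rightarrow> ('n, 'm, 'k::comm_ring_1) S_poly) \<Rightarrow> bool" where
  "lin_indep g \<longleftrightarrow>
     (\<forall>c :: 'n \<Rightarrow> 'k. (\<Sum>r\<in>UNIV. Poly_Mapping.single 0 (c r) * g r) = 0 \<longrightarrow> (\<forall>r. c r = 0))"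

text \<open>\<open>e r\<close> is the exponent vector of the monomial \<open>g\<^sub>r\<close>.\<close>

definition CW_Nagata ::
    "nat \<Rightarrow> nat \<Rightarrow> ('n::finite \<Rightarrow> 'm::finite \<Rightarrow> nat) \<Rightarrow> ('n, 'm, 'k::comm_ring_1) S_poly \<Rightarrow> bool" where
  "CW_Nagata d\<^sub>1 d\<^sub>2 e f \<longleftrightarrow>
     (\<forall>r. udeg (e r) = d\<^sub>2) \<and>
     lin_indep (\<lambda>r. umon (e r) :: ('n, 'm, 'k) S_poly) \<and>
     f = (\<Sum>r\<in>UNIV. xvar r ^ d\<^sub>1 * umon (e r))"

text \<open>
  CW-complexes are represented by their sets of cells.  The vertex \<open>u\<^sub>k\<^sup>i\<close> (the \<open>i\<close>-th copy of \<open>u\<^sub>k\<close>)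
  is the pair \<open>(k, i)\<close>, and a face of a simplex is its nonempty finite set of vertices.  Two faces
  are identified if they involve the same number of copies of each variable, and a cell is a class
  of identified faces.  As the classes are taken among the faces of all simplices at once, the
  complexes \<open>X\<^sub>g\<close> are already glued along their common subcomplexes, and containment of complexes is
  inclusion of sets of cells.
\<close>

type_synonym 'm face = "('m \<times> nat) set"

definition simplex_vertices :: "('m \<Rightarrow> nat) \<Rightarrow> ('m \<times> nat) set" where
  "simplex_vertices e = {(k, i). 1 \<le> i \<and> i \<le> e k}"

definition simplex_faces :: "('m \<Rightarrow> nat) \<Rightarrow> 'm face set" where
  "simplex_faces e = {F. F \<noteq> {} \<and> F \<subseteq> simplex_vertices e}"

definition copies :: "'m face \<Rightarrow> 'm \<Rightarrow> nat" where
  "copies F k = card {i. (k, i) \<in> F}"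

definition identified :: "('m face \<times> 'm face) set" where
  "identified =
     {(F, G). F \<in> (\<Union>e. simplex_faces e) \<and> G \<in> (\<Union>e. simplex_faces e) \<and> copies F = copies G}"

definition CW_X :: "('m \<Rightarrow> nat) \<Rightarrow> 'm face set set" where
  "CW_X e = (\<lambda>F. identified `` {F}) ` simplex_faces e"

text \<open>The elements of the \<open>k\<close>-skeleton of \<open>P(m)\<close>.\<close>

definition P_skeleton :: "nat \<Rightarrow> ('m::finite face set set) set" where
  "P_skeleton k = {CW_X h | h. udeg h = k + 1}"

definition CW_Delta :: "('n \<Rightarrow> 'm \<Rightarrow> nat) \<Rightarrow> 'm face set set" where
  "CW_Delta e = (\<Union>r. CW_X (e r))"

text \<open>
  Minimality is with respect to inclusion among the elements of all skeleta of \<open>P(m)\<close>; it is not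
  relative to a single skeleton, where distinct elements are never comparable.
\<close>

definition minimal_not_contained ::
    "'m::finite face set set \<Rightarrow> 'm face set set \<Rightarrow> bool" where
  "minimal_not_contained A D \<longleftrightarrow>
     \<not> A \<subseteq> D \<and> (\<forall>B\<in>(\<Union>k. P_skeleton k). B \<subset> A \<longrightarrow> B \<subseteq> D)"

lemma copies_le:
  assumes "F \<in> simplex_faces e"
  shows "copies F \<le> e"
proof (rule le_funI)
  fix k
  have "{i. (k, i) \<in> F} \<subseteq> {1..e k}"
    using assms by (auto simp: simplex_faces_def simplex_vertices_def)
  then show "copies F k \<le> e k"
    unfolding copies_def using card_mono[of "{1..e k}"] by fastforce
qed

lemma copies_simplex_vertices: "copies (simplex_vertices e) = e"
proof
  fix k
  have "{i. (k, i) \<in> simplex_vertices e} = {1..e k}"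
    by (auto simp: simplex_vertices_def)
  then show "copies (simplex_vertices e) k = e k"
    by (simp add: copies_def)
qed

lemma CW_X_subset_iff: "CW_X h \<subseteq> CW_X g \<longleftrightarrow> h \<le> g"
proof
  assume "h \<le> g"
  then have "simplex_vertices h \<subseteq> simplex_vertices g"
    unfolding simplex_vertices_def le_fun_def by (auto intro: order_trans)
  then show "CW_X h \<subseteq> CW_X g"
    unfolding CW_X_def simplex_faces_def by blast
next
  assume sub: "CW_X h \<subseteq> CW_X g"
  show "h \<le> g"
  proof (cases "simplex_vertices h = {}")
    case True
    have "h k = 0" for k
    proof -
      have "(k, h k) \<notin> simplex_vertices h" using True by simp
      then show ?thesis by (simp add: simplex_vertices_def)
    qed
    then show ?thesis by (simp add: le_fun_def)
  next
    case False
    let ?V = "simplex_vertices h"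
    have V: "?V \<in> simplex_faces h" using False by (simp add: simplex_faces_def)
    then obtain F where F: "F \<in> simplex_faces g" "identified `` {?V} = identified `` {F}"
      using sub unfolding CW_X_def by blast
    have "(?V, ?V) \<in> identified" using V unfolding identified_def by blast
    then have "(F, ?V) \<in> identified" using F(2) by blast
    then have "copies F = h" by (simp add: identified_def copies_simplex_vertices)
    then show ?thesis using copies_le[OF F(1)] by simp
  qed
qed

end

theory Submission imports Defs begin

text \<open>
  The coefficient of \<open>contract a f\<close> at \<open>w\<close> is \<open>\<Sum>s. a\<^sub>s f\<^sub>w\<^sub>+\<^sub>s\<close>, and \<open>f\<close> is a sum of distinct monomials
  \<open>x\<^sub>r\<^sup>d g\<^sub>r\<close>.  A monomial of \<open>a \<in> Ann f\<close> that does not itself annihilate \<open>f\<close> contributes to some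
  coefficient, hence is cancelled there by another monomial of \<open>a\<close>.  Two monomials contributing to
  the same coefficient differ by a multiple of a binomial of type 6.  Subtracting this multiple
  leaves an element of \<open>Ann f\<close> with fewer terms, so \<open>Ann f\<close> is generated by these binomials together
  with the monomials that annihilate \<open>f\<close>.
\<close>

section \<open>Generated ideals\<close>

lemma ideal_generated_base: "p \<in> G \<Longrightarrow> p \<in> ideal_generated G"
  unfolding ideal_generated_def by (rule module.span_base[OF module_times])

lemma ideal_generated_zero: "0 \<in> ideal_generated G"
  unfolding ideal_generated_def by (rule module.span_zero[OF module_times])

lemma ideal_generated_add:
  "p \<in> ideal_generated G \<Longrightarrow> q \<in> ideal_generated G \<Longrightarrow> p + q \<in> ideal_generated G"
  unfolding ideal_generated_def by (rule module.span_add[OF module_times])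

lemma ideal_generated_mult: "p \<in> ideal_generated G \<Longrightarrow> q * p \<in> ideal_generated G"
  unfolding ideal_generated_def by (rule module.span_scale[OF module_times])

lemma ideal_generated_subset:
  assumes "G \<subseteq> I" and "0 \<in> I" and "\<And>p q. p \<in> I \<Longrightarrow> q \<in> I \<Longrightarrow> p + q \<in> I"
    and "\<And>p q. p \<in> I \<Longrightarrow> q * p \<in> I"
  shows "ideal_generated G \<subseteq> I"
  unfolding ideal_generated_def
  by (rule module.span_minimal[OF module_times assms(1)])
    (use assms(2-) in \<open>simp add: module.subspace_def[OF module_times]\<close>)

section \<open>Contraction\<close>

text \<open>For a fixed \<open>w\<close>, each exponent \<open>s\<close> of \<open>a\<close> meets
  exactly one exponent of \<open>f\<close>, namely \<open>w + s\<close>, so the double sum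
  collapses. The index set may exceed the support of \<open>a\<close>, so that two operators can be
  compared over a common set.\<close>

lemma lookup_contract_superset:
  assumes "finite A" and "Poly_Mapping.keys a \<subseteq> A"
  shows "Poly_Mapping.lookup (contract a f) w =
    (\<Sum>s\<in>A. Poly_Mapping.lookup a s * Poly_Mapping.lookup f (w + s))"
proof -
  \<comment> \<open>Subtraction of exponents is truncated, so \<open>t - s = w\<close> determines
    \<open>t\<close> only together with the componentwise inequality.\<close>
  have iff: "(\<forall>v. Poly_Mapping.lookup s v \<le> Poly_Mapping.lookup t v) \<and> t - s = w \<longleftrightarrow> t = w + s"
    for s t :: "('a, 'b) expo"
  proof
    assume h: "(\<forall>v. Poly_Mapping.lookup s v \<le> Poly_Mapping.lookup t v) \<and> t - s = w"
    then have w: "w = t - s" and le: "\<And>v. Poly_Mapping.lookup s v \<le> Poly_Mapping.lookup t v"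
      by simp_all
    show "t = w + s"
      unfolding w using le by (intro poly_mapping_eqI) (simp add: lookup_add lookup_minus)
  qed (auto simp: lookup_add)
  have "Poly_Mapping.lookup (contract a f) w =
    (\<Sum>s\<in>Poly_Mapping.keys a. \<Sum>t\<in>Poly_Mapping.keys f.
      if t = w + s then Poly_Mapping.lookup a s * Poly_Mapping.lookup f t else 0)"
    unfolding contract_def lookup_sum
    by (intro sum.cong refl) (auto simp: lookup_single when_def iff[symmetric])
  also have "\<dots> = (\<Sum>s\<in>Poly_Mapping.keys a. Poly_Mapping.lookup a s * Poly_Mapping.lookup f (w + s))"
    by (intro sum.cong refl) (auto simp: not_in_keys_iff_lookup_eq_zero)
  also have "\<dots> = (\<Sum>s\<in>A. Poly_Mapping.lookup a s * Poly_Mapping.lookup f (w + s))"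
    using assms by (intro sum.mono_neutral_left) (auto simp: not_in_keys_iff_lookup_eq_zero)
  finally show ?thesis .
qed

lemmas lookup_contract = lookup_contract_superset[OF finite_keys subset_refl]

lemma contract_zero: "contract 0 f = 0"
  by (simp add: contract_def)

lemma contract_add: "contract (a + b) f = contract a f + contract b f"
proof (rule poly_mapping_eqI)
  fix w
  let ?A = "Poly_Mapping.keys a \<union> Poly_Mapping.keys b"
  have "Poly_Mapping.keys (a + b) \<subseteq> ?A" by (rule Poly_Mapping.keys_add)
  then show "Poly_Mapping.lookup (contract (a + b) f) w =
      Poly_Mapping.lookup (contract a f + contract b f) w"
    by (simp add: lookup_add lookup_contract_superset[of ?A] distrib_right sum.distrib)
qed

lemma lookup_contract_single:
  "Poly_Mapping.lookup (contract (Poly_Mapping.single s c) f) w = c * Poly_Mapping.lookup f (w + s)"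
  by (subst lookup_contract_superset[of "{s}"]) auto

lemma poly_mapping_eq_sum_single:
  "p = (\<Sum>s\<in>Poly_Mapping.keys p. Poly_Mapping.single s (Poly_Mapping.lookup p s))"
  by (rule poly_mapping_eqI)
    (auto simp: lookup_sum lookup_single when_def not_in_keys_iff_lookup_eq_zero)

text \<open>Builds a polynomial one term at a time; this reduces identities that are additive in a
  polynomial to monomials.\<close>

lemma poly_mapping_induct_single [case_names zero add]:
  fixes P :: "('a \<Rightarrow>\<^sub>0 'b::comm_monoid_add) \<Rightarrow> bool"
  assumes "P 0" and "\<And>s c p. P p \<Longrightarrow> P (Poly_Mapping.single s c + p)"
  shows "P p"
proof -
  have "P (\<Sum>s\<in>A. Poly_Mapping.single s (Poly_Mapping.lookup p s))" if "finite A" for A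
    using that by induction (auto intro: assms)
  then show ?thesis
    by (subst poly_mapping_eq_sum_single) simp
qed

text \<open>Contraction is a module action, which makes \<open>Ann f\<close> closed under
  multiplication by ring elements. Additivity in \<open>a\<close> and then in \<open>b\<close>
  leaves two monomials with exponents \<open>s\<close> and \<open>t\<close>, where both sides read
  off the coefficient of \<open>f\<close> at \<open>w + s + t\<close>.\<close>

lemma contract_mult: "contract (a * b) f = contract a (contract b f)"
proof (induction a rule: poly_mapping_induct_single)
  case zero
  show ?case by (simp add: contract_zero)
next
  case (add s c a)
  have "contract (Poly_Mapping.single s c * b) f = contract (Poly_Mapping.single s c) (contract b f)"
  proof (induction b rule: poly_mapping_induct_single)
    case zero
    show ?case by (rule poly_mapping_eqI) (simp add: contract_zero lookup_contract_single)
  next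
    case (add t d b)
    have "contract (Poly_Mapping.single s c * Poly_Mapping.single t d) f =
        contract (Poly_Mapping.single s c) (contract (Poly_Mapping.single t d) f)"
      by (rule poly_mapping_eqI) (simp add: mult_single lookup_contract_single ac_simps)
    with add show ?case
      by (intro poly_mapping_eqI)
        (simp add: contract_add distrib_left lookup_contract_single lookup_add)
  qed
  with add show ?case by (simp add: contract_add distrib_right)
qed

lemma contract_zero_right: "contract a 0 = 0"
  by (simp add: contract_def)

lemma Ann_zero: "0 \<in> Ann f"
  by (simp add: Ann_def contract_zero)

lemma Ann_add: "a \<in> Ann f \<Longrightarrow> b \<in> Ann f \<Longrightarrow> a + b \<in> Ann f"
  by (simp add: Ann_def contract_add)

lemma Ann_mult: "a \<in> Ann f \<Longrightarrow> b * a \<in> Ann f"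
  by (simp add: Ann_def contract_mult contract_zero_right)

lemma single_mem_Ann:
  "(\<And>w. Poly_Mapping.lookup f (w + s) = 0) \<Longrightarrow> Poly_Mapping.single s c \<in> Ann f"
  by (auto simp: Ann_def lookup_contract_single intro: poly_mapping_eqI)

text \<open>Reduces the theorem to single monomials and to pairs of monomials, for an arbitrary
  \<open>f\<close>. The induction is on the number of terms of \<open>a\<close>.\<close>

lemma Ann_eq_ideal_generatedI:
  fixes f :: "('n, 'm, 'k::idom) S_poly"
  assumes G: "G \<subseteq> Ann f"
    and single: "\<And>t. (\<And>w. Poly_Mapping.lookup f (w + t) = 0) \<Longrightarrow>
      Poly_Mapping.single t 1 \<in> ideal_generated G"
    and binomial: "\<And>s t w. s \<noteq> t \<Longrightarrow> Poly_Mapping.lookup f (w + s) \<noteq> 0 \<Longrightarrow>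
      Poly_Mapping.lookup f (w + t) \<noteq> 0 \<Longrightarrow>
      Poly_Mapping.single t 1 - Poly_Mapping.single s 1 \<in> ideal_generated G"
  shows "Ann f = ideal_generated G"
proof
  show sub: "ideal_generated G \<subseteq> Ann f"
    by (rule ideal_generated_subset[OF G Ann_zero Ann_add Ann_mult])
  have "a \<in> ideal_generated G" if "a \<in> Ann f" for a
    using that
  proof (induction "card (Poly_Mapping.keys a)" arbitrary: a rule: less_induct)
    case less
    show ?case
    proof (cases "a = 0")
      case True
      then show ?thesis by (simp add: ideal_generated_zero)
    next
      case False
      then have "Poly_Mapping.keys a \<noteq> {}" by simp
      then obtain t where t: "t \<in> Poly_Mapping.keys a" by blast
      let ?c = "Poly_Mapping.lookup a t"
      \<comment> \<open>Subtracting such a \<open>q\<close> removes the term at \<open>t\<close> and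
        introduces no new exponent, so the number of terms drops.\<close>
      obtain q where q: "q \<in> ideal_generated G" "Poly_Mapping.lookup q t = ?c"
        "Poly_Mapping.keys q \<subseteq> Poly_Mapping.keys a"
      proof (cases "\<forall>w. Poly_Mapping.lookup f (w + t) = 0")
        case True
        have "Poly_Mapping.single 0 ?c * Poly_Mapping.single t 1 \<in> ideal_generated G"
          using True by (intro ideal_generated_mult single) simp
        with t show ?thesis
          by (intro that[of "Poly_Mapping.single t ?c"]) (auto simp: mult_single)
      next
        case False
        then obtain w where w: "Poly_Mapping.lookup f (w + t) \<noteq> 0" by blast
        have "(\<Sum>s\<in>Poly_Mapping.keys a. Poly_Mapping.lookup a s * Poly_Mapping.lookup f (w + s)) = 0"
          using less.prems by (simp add: Ann_def flip: lookup_contract)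
        then have "?c * Poly_Mapping.lookup f (w + t) +
          (\<Sum>s\<in>Poly_Mapping.keys a - {t}. Poly_Mapping.lookup a s * Poly_Mapping.lookup f (w + s)) = 0"
          using t by (simp add: sum.remove)
        \<comment> \<open>A product of two nonzero scalars: this is where the absence of zero
          divisors enters.\<close>
        moreover have "?c * Poly_Mapping.lookup f (w + t) \<noteq> 0"
          using t w by (simp add: in_keys_iff)
        ultimately have
          "(\<Sum>s\<in>Poly_Mapping.keys a - {t}. Poly_Mapping.lookup a s * Poly_Mapping.lookup f (w + s)) \<noteq> 0"
          by auto
        then obtain s where s: "s \<in> Poly_Mapping.keys a" "s \<noteq> t" "Poly_Mapping.lookup f (w + s) \<noteq> 0"
          by (metis (no_types, lifting) DiffE insertI1 mult_zero_right sum.neutral)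
        \<comment> \<open>Matching the coefficient at \<open>t\<close> alone suffices: the
          coefficient of \<open>a\<close> at \<open>s\<close> may change, but \<open>s\<close> is
          already an exponent of \<open>a\<close>.\<close>
        define q where "q = Poly_Mapping.single t ?c - Poly_Mapping.single s ?c"
        have "q = Poly_Mapping.single 0 ?c * (Poly_Mapping.single t 1 - Poly_Mapping.single s 1)"
          by (simp add: q_def right_diff_distrib mult_single)
        then have "q \<in> ideal_generated G"
          using binomial[OF s(2,3) w] by (simp add: ideal_generated_mult)
        moreover have "Poly_Mapping.lookup q t = ?c"
          using s by (simp add: q_def lookup_minus lookup_single)
        moreover have "Poly_Mapping.keys q \<subseteq> Poly_Mapping.keys a"
          using s t unfolding q_def by (auto dest!: keys_diff[THEN subsetD] split: if_splits)
        ultimately show ?thesis by (rule that)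
      qed
      have "Poly_Mapping.keys (a - q) \<subseteq> Poly_Mapping.keys a - {t}"
        using q keys_diff[of a q] by (auto simp: in_keys_iff lookup_minus)
      then have "card (Poly_Mapping.keys (a - q)) < card (Poly_Mapping.keys a)"
        using t by (intro psubset_card_mono) auto
      moreover have "a - q \<in> Ann f"
        using Ann_add[OF less.prems Ann_mult[of q f "-1"]] q(1) sub by auto
      ultimately have "a - q \<in> ideal_generated G" by (rule less.hyps)
      from ideal_generated_add[OF this q(1)] show ?thesis by simp
    qed
  qed
  then show "Ann f \<subseteq> ideal_generated G" by blast
qed

section \<open>Monomials\<close>

definition xexp :: "'n \<Rightarrow> nat \<Rightarrow> ('n, 'm) expo" where
  "xexp r d = Poly_Mapping.single (Inl r) d"

definition uexp :: "('m::finite \<Rightarrow> nat) \<Rightarrow> ('n, 'm) expo" where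
  "uexp \<beta> = (\<Sum>j\<in>UNIV. Poly_Mapping.single (Inr j) (\<beta> j))"

lemma lookup_xexp [simp]:
  "Poly_Mapping.lookup (xexp r d) (Inl i) = (if i = r then d else 0)"
  "Poly_Mapping.lookup (xexp r d) (Inr j) = 0"
  by (auto simp: xexp_def lookup_single when_def)

lemma lookup_uexp [simp]:
  "Poly_Mapping.lookup (uexp \<beta>) (Inl i) = 0"
  "Poly_Mapping.lookup (uexp \<beta>) (Inr j) = \<beta> j"
  by (auto simp: uexp_def lookup_sum lookup_single when_def)

lemma expo_eq_iff:
  "s = t \<longleftrightarrow> (\<forall>i. Poly_Mapping.lookup s (Inl i) = Poly_Mapping.lookup t (Inl i)) \<and>
    (\<forall>j. Poly_Mapping.lookup s (Inr j) = Poly_Mapping.lookup t (Inr j))"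
  for s t :: "('n, 'm) expo"
  by (metis obj_sumE poly_mapping_eqI)

lemma xvar_power: "xvar r ^ d = Poly_Mapping.single (xexp r d) 1"
  by (induction d) (simp_all add: xvar_def xexp_def mult_single flip: single_add)

lemma uvar_power: "uvar j ^ d = Poly_Mapping.single (Poly_Mapping.single (Inr j) d) 1"
  by (induction d) (simp_all add: uvar_def mult_single flip: single_add)

lemma prod_single:
  "(\<Prod>j\<in>A. Poly_Mapping.single (s j) 1) = Poly_Mapping.single (\<Sum>j\<in>A. s j) (1 :: 'k::comm_ring_1)"
  for s :: "'j \<Rightarrow> 'a::comm_monoid_add"
  by (induction A rule: infinite_finite_induct) (simp_all add: mult_single)

lemma umon_eq_single: "umon \<beta> = Poly_Mapping.single (uexp \<beta>) 1"
  by (simp add: umon_def uvar_power prod_single uexp_def)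

text \<open>The cofactor has exponent \<open>t - s\<close>, where the truncated difference is exact
  by the componentwise inequality. Thus a monomial lies in the ideal as soon as one of its divisors
  does.\<close>

lemma single_mono_ideal_generated:
  fixes s t :: "('n, 'm) expo"
  assumes "Poly_Mapping.single s 1 \<in> ideal_generated G"
    and "\<And>v. Poly_Mapping.lookup s v \<le> Poly_Mapping.lookup t v"
  shows "(Poly_Mapping.single t 1 :: ('n, 'm, 'k::comm_ring_1) S_poly) \<in> ideal_generated G"
proof -
  have "t = (t - s) + s"
    using assms(2) by (intro poly_mapping_eqI) (simp add: lookup_add lookup_minus)
  then have "Poly_Mapping.single t 1 = Poly_Mapping.single (t - s) 1 * Poly_Mapping.single s (1 :: 'k)"
    by (simp add: mult_single)
  with ideal_generated_mult[OF assms(1)] show ?thesis by simp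
qed

lemma uvar_dvd_umon: "\<beta> i \<noteq> 0 \<Longrightarrow> uvar i dvd umon \<beta>"
  unfolding umon_def
  by (rule dvd_trans[of _ "uvar i ^ \<beta> i"]) (auto intro: dvd_power dvd_prodI)

lemma single_eq_single_iff: "Poly_Mapping.single s 1 = Poly_Mapping.single t (1::'k::zero_neq_one) \<longleftrightarrow> s = t"
  by (metis lookup_single_eq lookup_single_not_eq zero_neq_one)

text \<open>Turns the factorizations through the gcd in the binomial generators into equations
  between exponents.\<close>

lemma umon_eq_mult_iff:
  "(umon \<alpha> :: ('n, 'm::finite, 'k::comm_ring_1) S_poly) = umon \<beta> * umon \<gamma> \<longleftrightarrow>
    (\<forall>j. \<alpha> j = \<beta> j + \<gamma> j)"
  by (simp add: umon_eq_single mult_single single_eq_single_iff expo_eq_iff lookup_add)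

lemma udeg_mono: "\<alpha> \<le> \<beta> \<Longrightarrow> udeg \<alpha> \<le> udeg \<beta>"
  unfolding udeg_def by (rule sum_mono) (simp add: le_fun_def)

lemma udeg_strict_mono: "\<alpha> < \<beta> \<Longrightarrow> udeg \<alpha> < udeg \<beta>"
  unfolding udeg_def by (rule sum_strict_mono_ex1) (auto simp: Orderings.less_fun_def le_fun_def not_le)

lemma udeg_add: "(\<And>j. \<alpha> j = \<beta> j + \<gamma> j) \<Longrightarrow> udeg \<alpha> = udeg \<beta> + udeg \<gamma>"
  by (simp add: udeg_def sum.distrib)

text \<open>Lowering one positive exponent by one lowers the degree by exactly one, so every smaller
  degree is reached. This supplies a divisor of degree exactly \<open>d\<^sub>2 + 1\<close> for any
  monomial of larger degree.\<close>

lemma exists_divisor_of_degree: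
  assumes "d \<le> udeg \<beta>"
  obtains \<alpha> where "\<alpha> \<le> \<beta>" "udeg \<alpha> = d"
proof -
  have "\<exists>\<alpha>\<le>\<beta>. udeg \<alpha> = d"
    using assms
  proof (induction "udeg \<beta>" arbitrary: \<beta> rule: less_induct)
    case less
    show ?case
    proof (cases "udeg \<beta> = d")
      case False
      then have "udeg \<beta> \<noteq> 0" using less.prems by simp
      then obtain j where j: "\<beta> j \<noteq> 0" by (auto simp: udeg_def)
      let ?\<gamma> = "\<beta>(j := \<beta> j - 1)"
      \<comment> \<open>The indicator of \<open>j\<close> is the exponent vector of the variable
        that is split off.\<close>
      have "udeg \<beta> = udeg ?\<gamma> + udeg (\<lambda>k. if k = j then 1 else 0)"
        using j by (intro udeg_add) simp
      then have eq: "udeg \<beta> = udeg ?\<gamma> + 1" by (simp add: udeg_def)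
      then have "\<exists>\<alpha>\<le>?\<gamma>. udeg \<alpha> = d"
        using less.prems False by (intro less.hyps) auto
      moreover have "?\<gamma> \<le> \<beta>" by (simp add: le_fun_def)
      ultimately show ?thesis using order_trans by blast
    qed auto
  qed
  with that show ?thesis by blast
qed

section \<open>The complex of a family of monomials\<close>

text \<open>The class of the full vertex set is the top cell of \<open>CW_X h\<close>. Identified
  faces have the same \<open>copies\<close>, and those of the full vertex set recover
  \<open>h\<close>. For \<open>h = 0\<close> there is no such cell, as faces are nonempty.\<close>

lemma CW_X_top_cell:
  assumes "simplex_vertices h \<noteq> {}"
  shows "identified `` {simplex_vertices h} \<in> CW_X g \<longleftrightarrow> h \<le> g"
proof
  let ?V = "simplex_vertices h"
  have V: "?V \<in> simplex_faces h" using assms by (simp add: simplex_faces_def)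
  show "h \<le> g" if "identified `` {?V} \<in> CW_X g"
  proof -
    from that obtain F where F: "F \<in> simplex_faces g" "identified `` {?V} = identified `` {F}"
      unfolding CW_X_def by blast
    have "(?V, ?V) \<in> identified" using V unfolding identified_def by blast
    then have "(F, ?V) \<in> identified" using F(2) by blast
    then have "copies F = h" by (simp add: identified_def copies_simplex_vertices)
    then show ?thesis using copies_le[OF F(1)] by simp
  qed
  show "identified `` {?V} \<in> CW_X g" if "h \<le> g"
    using V that CW_X_subset_iff[of h g] unfolding CW_X_def by blast
qed

lemma simplex_vertices_eq_empty_iff: "simplex_vertices h = {} \<longleftrightarrow> (\<forall>k. h k = 0)"
proof
  assume empty: "simplex_vertices h = {}"
  show "\<forall>k. h k = 0"
  proof
    fix k
    have "(k, h k) \<notin> simplex_vertices h" using empty by simp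
    then show "h k = 0" by (simp add: simplex_vertices_def)
  qed
qed (auto simp: simplex_vertices_def)

text \<open>A subcomplex of a union need not lie in one of its members, but here the top cell of
  \<open>CW_X h\<close> lies in some \<open>CW_X (e r)\<close>, which then contains all of
  \<open>CW_X h\<close>.\<close>

lemma CW_X_subset_CW_Delta_iff: "CW_X h \<subseteq> CW_Delta e \<longleftrightarrow> (\<exists>r. h \<le> e r)"
proof
  assume sub: "CW_X h \<subseteq> CW_Delta e"
  show "\<exists>r. h \<le> e r"
  proof (cases "simplex_vertices h = {}")
    \<comment> \<open>The zero exponent lies below every \<open>e r\<close>, so any index is a
      witness.\<close>
    case True
    then show ?thesis by (simp add: simplex_vertices_eq_empty_iff le_fun_def)
  next
    case False
    then have "identified `` {simplex_vertices h} \<in> CW_Delta e"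
      using sub CW_X_top_cell[of h h] by blast
    then show ?thesis
      using False by (auto simp: CW_Delta_def CW_X_top_cell)
  qed
next
  assume "\<exists>r. h \<le> e r"
  then show "CW_X h \<subseteq> CW_Delta e"
    unfolding CW_Delta_def CW_X_subset_iff[symmetric] by blast
qed

text \<open>In degree zero the complex has no cells and is contained in every
  \<open>D\<close>.\<close>

lemma udeg_pos_if_not_CW_X_subset:
  assumes "\<not> CW_X h \<subseteq> D"
  shows "udeg h \<ge> 1"
proof (rule ccontr)
  assume "\<not> udeg h \<ge> 1"
  then have "\<forall>k. h k = 0" by (simp add: udeg_def not_le)
  then have "simplex_vertices h = {}" by (simp add: simplex_vertices_eq_empty_iff)
  with assms show False by (auto simp: CW_X_def simplex_faces_def)
qed

lemma CW_X_mem_P_skeleton: "udeg h \<ge> 1 \<Longrightarrow> CW_X h \<in> P_skeleton (udeg h - 1)"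
  by (auto simp: P_skeleton_def)

text \<open>Descent on the degree: a failure of minimality yields a proper divisor whose complex is
  still not contained in \<open>D\<close>. The set \<open>D\<close> is arbitrary, so that it may be
  the whole complex or the complex of one monomial.\<close>

lemma exists_minimal_not_contained:
  assumes "\<not> CW_X h \<subseteq> D"
  obtains h' where "h' \<le> h" "minimal_not_contained (CW_X h') D"
proof -
  have "\<exists>h'\<le>h. minimal_not_contained (CW_X h') D"
    using assms
  proof (induction "udeg h" arbitrary: h rule: less_induct)
    case less
    show ?case
    proof (cases "minimal_not_contained (CW_X h) D")
      case False
      then obtain g where g: "CW_X g \<subset> CW_X h" "\<not> CW_X g \<subseteq> D"
        using less.prems by (auto simp: minimal_not_contained_def P_skeleton_def)
      then have "g < h" by (auto simp: psubset_eq CW_X_subset_iff less_le)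
      then show ?thesis
        using less.hyps[OF udeg_strict_mono g(2)] by (meson order_trans less_imp_le)
    qed auto
  qed
  with that show ?thesis by blast
qed

section \<open>CW-Nagata polynomials\<close>

lemma CW_Nagata_eq_sum_single:
  assumes "CW_Nagata d\<^sub>1 d\<^sub>2 e f"
  shows "f = (\<Sum>r\<in>UNIV. Poly_Mapping.single (xexp r d\<^sub>1 + uexp (e r)) 1)"
  using assms by (simp add: CW_Nagata_def xvar_power umon_eq_single mult_single)

lemma lookup_CW_Nagata_nonzeroE:
  fixes f :: "('n::finite, 'm::finite, 'k::comm_ring_1) S_poly"
  assumes "CW_Nagata d\<^sub>1 d\<^sub>2 e f" and "Poly_Mapping.lookup f v \<noteq> 0"
  obtains r where "v = xexp r d\<^sub>1 + uexp (e r)"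
proof -
  have "(\<Sum>r\<in>UNIV.
      Poly_Mapping.lookup (Poly_Mapping.single (xexp r d\<^sub>1 + uexp (e r)) (1::'k)) v) \<noteq> 0"
    using assms(2) unfolding CW_Nagata_eq_sum_single[OF assms(1)] lookup_sum .
  then obtain r where
    "Poly_Mapping.lookup (Poly_Mapping.single (xexp r d\<^sub>1 + uexp (e r)) (1::'k)) v \<noteq> 0"
    by (meson sum.not_neutral_contains_not_neutral)
  then have "v = xexp r d\<^sub>1 + uexp (e r)"
    by (auto simp: lookup_single when_def split: if_splits)
  then show ?thesis by (rule that)
qed

text \<open>As \<open>d\<^sub>1\<close> is positive, the x-part of the exponent determines
  \<open>r\<close>, so exactly one summand contributes.\<close>

lemma lookup_CW_Nagata_eq_1:
  assumes "CW_Nagata d\<^sub>1 d\<^sub>2 e f" and "d\<^sub>1 \<ge> 1"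
  shows "Poly_Mapping.lookup f (xexp r d\<^sub>1 + uexp (e r)) = 1"
proof -
  have "xexp r' d\<^sub>1 + uexp (e r') = xexp r d\<^sub>1 + uexp (e r) \<longleftrightarrow> r' = r" for r'
    using assms(2) by (auto simp: expo_eq_iff lookup_add split: if_splits)
  then show ?thesis
    by (simp add: CW_Nagata_eq_sum_single[OF assms(1)] lookup_sum lookup_single when_def)
qed

text \<open>A monomial operator kills \<open>f\<close> if it divides no monomial of
  \<open>f\<close>. For each monomial generator it remains to name, for every \<open>r\<close>, a
  variable whose exponent is too large.\<close>

lemma single_mem_Ann_CW_Nagata:
  assumes "CW_Nagata d\<^sub>1 d\<^sub>2 e f"
    and "\<And>r. \<exists>v. Poly_Mapping.lookup (xexp r d\<^sub>1 + uexp (e r)) v < Poly_Mapping.lookup s v"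
  shows "Poly_Mapping.single s c \<in> Ann f"
proof (rule single_mem_Ann, rule ccontr)
  fix w
  assume "Poly_Mapping.lookup f (w + s) \<noteq> 0"
  then obtain r where "w + s = xexp r d\<^sub>1 + uexp (e r)"
    by (rule lookup_CW_Nagata_nonzeroE[OF assms(1)])
  with assms(2)[of r] show False
    by (metis lookup_add le_add2 not_less)
qed

text \<open>Both monomials contract \<open>f\<close> to the same monomial
  \<open>umon \<gamma>\<close>, so their difference kills \<open>f\<close>. Here
  \<open>\<gamma>\<close> may be any common divisor with the given cofactors.\<close>

lemma binomial_mem_Ann:
  fixes f :: "('n::finite, 'm::finite, 'k::comm_ring_1) S_poly"
  assumes f: "CW_Nagata d\<^sub>1 d\<^sub>2 e f" and d: "d\<^sub>1 \<ge> 1"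
    and \<rho>: "\<And>j. e r j = \<rho> j + \<gamma> j" and \<sigma>: "\<And>j. e s j = \<sigma> j + \<gamma> j"
  shows "(xvar r ^ d\<^sub>1 * umon \<rho> - xvar s ^ d\<^sub>1 * umon \<sigma> :: ('n, 'm, 'k) S_poly) \<in> Ann f"
proof -
  have coeff: "Poly_Mapping.lookup f (w + (xexp r d\<^sub>1 + uexp \<rho>)) =
      (if w = uexp \<gamma> then 1 else 0)"
    if \<rho>: "\<And>j. e r j = \<rho> j + \<gamma> j" for w r \<rho>
  proof (cases "Poly_Mapping.lookup f (w + (xexp r d\<^sub>1 + uexp \<rho>)) = 0")
    case True
    have "w \<noteq> uexp \<gamma>"
    proof
      assume "w = uexp \<gamma>"
      then have "w + (xexp r d\<^sub>1 + uexp \<rho>) = xexp r d\<^sub>1 + uexp (e r)"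
        using \<rho> by (simp add: expo_eq_iff lookup_add)
      with True lookup_CW_Nagata_eq_1[OF f d, of r] show False by simp
    qed
    with True show ?thesis by simp
  next
    case False
    then obtain r' where r': "w + (xexp r d\<^sub>1 + uexp \<rho>) = xexp r' d\<^sub>1 + uexp (e r')"
      by (rule lookup_CW_Nagata_nonzeroE[OF f])
    \<comment> \<open>The left side is positive, so term \<open>r'\<close> must involve the variable
      with index \<open>r\<close>.\<close>
    have "Poly_Mapping.lookup w (Inl r) + d\<^sub>1 = (if r = r' then d\<^sub>1 else 0)"
      using arg_cong[OF r', of "\<lambda>t. Poly_Mapping.lookup t (Inl r)"] by (simp add: lookup_add)
    with d have "r' = r" by (auto split: if_splits)
    with r' have "w = uexp \<gamma>"
      using \<rho> by (auto simp: expo_eq_iff lookup_add)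
    moreover have "Poly_Mapping.lookup f (w + (xexp r d\<^sub>1 + uexp \<rho>)) = 1"
      using r' lookup_CW_Nagata_eq_1[OF f d] by simp
    ultimately show ?thesis by simp
  qed
  let ?t = "xexp r d\<^sub>1 + uexp \<rho>" and ?t' = "xexp s d\<^sub>1 + uexp \<sigma>"
  have "xvar r ^ d\<^sub>1 * umon \<rho> - xvar s ^ d\<^sub>1 * umon \<sigma> =
      Poly_Mapping.single ?t 1 + Poly_Mapping.single ?t' (-1 :: 'k)"
    by (simp add: xvar_power umon_eq_single mult_single single_uminus)
  moreover have "contract (Poly_Mapping.single ?t 1 + Poly_Mapping.single ?t' (-1)) f = 0"
  proof (rule poly_mapping_eqI)
    fix w
    have "Poly_Mapping.lookup f (w + ?t) = Poly_Mapping.lookup f (w + ?t')"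
      using coeff[OF \<rho>] coeff[OF \<sigma>] by simp
    then show "Poly_Mapping.lookup
        (contract (Poly_Mapping.single ?t 1 + Poly_Mapping.single ?t' (-1)) f) w =
        Poly_Mapping.lookup 0 w"
      by (simp only: contract_add lookup_add lookup_contract_single) simp
  qed
  ultimately show ?thesis by (simp only: Ann_def mem_Collect_eq)
qed

theorem theorem3p18:
  fixes f :: "('n::finite, 'm::finite, 'k::field_char_0) S_poly"
    and e :: "'n \<Rightarrow> 'm \<Rightarrow> nat"
    and d\<^sub>1 d\<^sub>2 :: nat
  assumes "d\<^sub>1 \<ge> 1" and "d\<^sub>2 \<ge> 2"
    and "CW_Nagata d\<^sub>1 d\<^sub>2 e f"
  shows "Ann f = ideal_generated (
      {xvar i * xvar j | i j. i \<noteq> j} \<union> {xvar k ^ (d\<^sub>1 + 1) | k. True}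
    \<union> {umon s | s. udeg s = d\<^sub>2 + 1}
    \<union> {umon s | s j. udeg s = j \<and> j \<in> {1..d\<^sub>2} \<and> CW_X s \<in> P_skeleton (j - 1) \<and>
          minimal_not_contained (CW_X s) (CW_Delta e)}
    \<union> {xvar r * uvar i | r i. \<not> (uvar i :: ('n, 'm, 'k) S_poly) dvd umon (e r)}
    \<union> {xvar s * umon \<rho> | s \<rho> j. udeg \<rho> = j \<and> j \<in> {1..d\<^sub>2} \<and> CW_X \<rho> \<in> P_skeleton (j - 1) \<and>
          minimal_not_contained (CW_X \<rho>) (CW_X (e s))}
    \<union> {xvar r ^ d\<^sub>1 * umon \<rho> - xvar s ^ d\<^sub>1 * umon \<sigma> | r s \<rho> \<sigma> j.
          udeg \<rho> = j \<and> udeg \<sigma> = j \<and>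
          (umon (e r) :: ('n, 'm, 'k) S_poly) = umon \<rho> * umon (inf (e r) (e s)) \<and>
          (umon (e s) :: ('n, 'm, 'k) S_poly) = umon \<sigma> * umon (inf (e r) (e s))})" (is "_ = ideal_generated ?G")
proof (rule Ann_eq_ideal_generatedI)
  note f = assms(3)
  have deg: "udeg (e r) = d\<^sub>2" for r using f by (simp add: CW_Nagata_def)
  have xvar: "xvar r = (Poly_Mapping.single (xexp r 1) 1 :: ('n, 'm, 'k) S_poly)" for r
    using xvar_power[of r 1] by simp
  have uvar: "uvar i = (Poly_Mapping.single (Poly_Mapping.single (Inr i) 1) 1 :: ('n, 'm, 'k) S_poly)" for i
    by (simp add: uvar_def)
  note lookup = lookup_add lookup_single when_def

  \<comment> \<open>The generators annihilate \<open>f\<close>\<close>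
  show "?G \<subseteq> Ann f"
  proof (intro Un_least subsetI)
    fix p :: "('n, 'm, 'k) S_poly"
    assume "p \<in> {xvar i * xvar j | i j. i \<noteq> j}"
    then obtain i j where p: "p = Poly_Mapping.single (xexp i 1 + xexp j 1) 1" and "i \<noteq> j"
      by (auto simp: xvar mult_single)
    \<comment> \<open>Term \<open>r\<close> involves no x-variable other than that of index
      \<open>r\<close>, and one of \<open>i\<close>, \<open>j\<close> differs from
      \<open>r\<close>.\<close>
    have "\<exists>v. Poly_Mapping.lookup (xexp r d\<^sub>1 + uexp (e r)) v <
        Poly_Mapping.lookup (xexp i 1 + xexp j 1) v" for r
      using \<open>i \<noteq> j\<close> by (intro exI[of _ "Inl (if r = i then j else i)"]) (auto simp: lookup)
    then show "p \<in> Ann f" unfolding p by (rule single_mem_Ann_CW_Nagata[OF f])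
  next
    fix p :: "('n, 'm, 'k) S_poly"
    assume "p \<in> {xvar k ^ (d\<^sub>1 + 1) | k. True}"
    then obtain k where p: "p = Poly_Mapping.single (xexp k (d\<^sub>1 + 1)) 1"
      unfolding xvar_power by auto
    have "\<exists>v. Poly_Mapping.lookup (xexp r d\<^sub>1 + uexp (e r)) v <
        Poly_Mapping.lookup (xexp k (d\<^sub>1 + 1)) v" for r
      by (intro exI[of _ "Inl k"]) (auto simp: lookup)
    then show "p \<in> Ann f" unfolding p by (rule single_mem_Ann_CW_Nagata[OF f])
  next
    fix p :: "('n, 'm, 'k) S_poly"
    assume "p \<in> {umon s | s. udeg s = d\<^sub>2 + 1}"
    then obtain s where p: "p = Poly_Mapping.single (uexp s) 1" and s: "udeg s = d\<^sub>2 + 1"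
      by (auto simp: umon_eq_single)
    have "\<exists>v. Poly_Mapping.lookup (xexp r d\<^sub>1 + uexp (e r)) v < Poly_Mapping.lookup (uexp s) v" for r
    proof -
      have "\<not> s \<le> e r" using udeg_mono[of s "e r"] s deg by auto
      then obtain j where "e r j < s j" by (auto simp: le_fun_def not_le)
      then show ?thesis by (intro exI[of _ "Inr j"]) (simp add: lookup)
    qed
    then show "p \<in> Ann f" unfolding p by (rule single_mem_Ann_CW_Nagata[OF f])
  next
    fix p :: "('n, 'm, 'k) S_poly"
    assume "p \<in> {umon s | s j. udeg s = j \<and> j \<in> {1..d\<^sub>2} \<and> CW_X s \<in> P_skeleton (j - 1) \<and>
          minimal_not_contained (CW_X s) (CW_Delta e)}"
    then obtain s where p: "p = Poly_Mapping.single (uexp s) 1" and s: "\<not> CW_X s \<subseteq> CW_Delta e"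
      by (auto simp: umon_eq_single minimal_not_contained_def)
    have "\<exists>v. Poly_Mapping.lookup (xexp r d\<^sub>1 + uexp (e r)) v < Poly_Mapping.lookup (uexp s) v" for r
    proof -
      have "\<not> s \<le> e r" using s by (simp add: CW_X_subset_CW_Delta_iff)
      then obtain j where "e r j < s j" by (auto simp: le_fun_def not_le)
      then show ?thesis by (intro exI[of _ "Inr j"]) (simp add: lookup)
    qed
    then show "p \<in> Ann f" unfolding p by (rule single_mem_Ann_CW_Nagata[OF f])
  next
    fix p :: "('n, 'm, 'k) S_poly"
    assume "p \<in> {xvar r * uvar i | r i. \<not> (uvar i :: ('n, 'm, 'k) S_poly) dvd umon (e r)}"
    then obtain r i where p': "p = xvar r * uvar i"
      and ndvd: "\<not> (uvar i :: ('n, 'm, 'k) S_poly) dvd umon (e r)"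
      by blast
    have p: "p = Poly_Mapping.single (xexp r 1 + Poly_Mapping.single (Inr i) 1) 1"
      unfolding p' xvar uvar by (simp add: mult_single)
    have i: "e r i = 0" using ndvd uvar_dvd_umon by blast
    \<comment> \<open>Term \<open>r\<close> lacks the u-variable of index \<open>i\<close>, and
      every other term lacks the x-variable of index \<open>r\<close>.\<close>
    have "\<exists>v. Poly_Mapping.lookup (xexp r' d\<^sub>1 + uexp (e r')) v <
        Poly_Mapping.lookup (xexp r 1 + Poly_Mapping.single (Inr i) 1) v" for r'
      using i by (intro exI[of _ "if r' = r then Inr i else Inl r"]) (auto simp: lookup)
    then show "p \<in> Ann f" unfolding p by (rule single_mem_Ann_CW_Nagata[OF f])
  next
    fix p :: "('n, 'm, 'k) S_poly"
    assume "p \<in> {xvar s * umon \<rho> | s \<rho> j. udeg \<rho> = j \<and> j \<in> {1..d\<^sub>2} \<and>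
      CW_X \<rho> \<in> P_skeleton (j - 1) \<and> minimal_not_contained (CW_X \<rho>) (CW_X (e s))}"
    then obtain s \<rho> where p: "p = Poly_Mapping.single (xexp s 1 + uexp \<rho>) 1" and "\<not> \<rho> \<le> e s"
      by (auto simp: xvar umon_eq_single mult_single minimal_not_contained_def CW_X_subset_iff)
    then obtain j where "e s j < \<rho> j" by (auto simp: le_fun_def not_le)
    then have "\<exists>v. Poly_Mapping.lookup (xexp r d\<^sub>1 + uexp (e r)) v <
        Poly_Mapping.lookup (xexp s 1 + uexp \<rho>) v" for r
      by (intro exI[of _ "if r = s then Inr j else Inl s"]) (auto simp: lookup)
    then show "p \<in> Ann f" unfolding p by (rule single_mem_Ann_CW_Nagata[OF f])
  next
    fix p :: "('n, 'm, 'k) S_poly"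
    assume "p \<in> {xvar r ^ d\<^sub>1 * umon \<rho> - xvar s ^ d\<^sub>1 * umon \<sigma> | r s \<rho> \<sigma> j.
          udeg \<rho> = j \<and> udeg \<sigma> = j \<and>
          (umon (e r) :: ('n, 'm, 'k) S_poly) = umon \<rho> * umon (inf (e r) (e s)) \<and>
          (umon (e s) :: ('n, 'm, 'k) S_poly) = umon \<sigma> * umon (inf (e r) (e s))}"
    then show "p \<in> Ann f"
      unfolding umon_eq_mult_iff using binomial_mem_Ann[OF f assms(1)] by blast
  qed

  \<comment> \<open>Membership of the generators, written through exponents\<close>
  have G1: "Poly_Mapping.single (xexp i 1 + xexp j 1) 1 \<in> ideal_generated ?G" if "i \<noteq> j" for i j
    using that by (intro ideal_generated_base UnI1) (auto simp: xvar mult_single)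
  have G1': "Poly_Mapping.single (xexp k (d\<^sub>1 + 1)) 1 \<in> ideal_generated ?G" for k
    unfolding xvar_power[symmetric] by (rule ideal_generated_base) blast
  have G2: "Poly_Mapping.single (uexp s) 1 \<in> ideal_generated ?G" if "udeg s = d\<^sub>2 + 1" for s
    unfolding umon_eq_single[symmetric] using that by (intro ideal_generated_base) blast
  have G3: "Poly_Mapping.single (uexp s) 1 \<in> ideal_generated ?G"
    if "udeg s \<le> d\<^sub>2" "minimal_not_contained (CW_X s) (CW_Delta e)" for s
  proof -
    \<comment> \<open>This gives the lower bound in \<open>{1..d\<^sub>2}\<close> and makes the
      skeleton index \<open>udeg s - 1\<close> exact.\<close>
    have "udeg s \<ge> 1"
      using that(2) udeg_pos_if_not_CW_X_subset by (auto simp: minimal_not_contained_def)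
    then show ?thesis
      unfolding umon_eq_single[symmetric] using that CW_X_mem_P_skeleton[of s]
      by (intro ideal_generated_base) auto
  qed
  have G5: "Poly_Mapping.single (xexp r 1 + uexp s) 1 \<in> ideal_generated ?G"
    if "udeg s \<le> d\<^sub>2" "minimal_not_contained (CW_X s) (CW_X (e r))" for r s
  proof -
    have "udeg s \<ge> 1"
      using that(2) udeg_pos_if_not_CW_X_subset by (auto simp: minimal_not_contained_def)
    moreover have "Poly_Mapping.single (xexp r 1 + uexp s) 1 =
        (xvar r * umon s :: ('n, 'm, 'k) S_poly)"
      by (simp add: xvar umon_eq_single mult_single)
    ultimately show ?thesis
      using that CW_X_mem_P_skeleton[of s] by (intro ideal_generated_base) auto
  qed
  have G6: "xvar r ^ d\<^sub>1 * umon (e r - inf (e r) (e s)) - xvar s ^ d\<^sub>1 * umon (e s - inf (e r) (e s))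
      \<in> ideal_generated ?G" for r s
  proof -
    let ?\<rho> = "e r - inf (e r) (e s)" and ?\<sigma> = "e s - inf (e r) (e s)"
    have \<rho>: "e r j = ?\<rho> j + inf (e r) (e s) j" and \<sigma>: "e s j = ?\<sigma> j + inf (e r) (e s) j" for j
      by (simp_all add: inf_min)
    \<comment> \<open>Both monomials have degree \<open>d\<^sub>2\<close>, so removing their gcd
      leaves cofactors of equal degree.\<close>
    have "udeg ?\<rho> = udeg ?\<sigma>"
      using udeg_add[of "e r" ?\<rho> "inf (e r) (e s)", OF \<rho>]
        udeg_add[of "e s" ?\<sigma> "inf (e r) (e s)", OF \<sigma>] deg[of r] deg[of s] by linarith
    moreover have "(umon (e r) :: ('n, 'm, 'k) S_poly) = umon ?\<rho> * umon (inf (e r) (e s))"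
      "(umon (e s) :: ('n, 'm, 'k) S_poly) = umon ?\<sigma> * umon (inf (e r) (e s))"
      unfolding umon_eq_mult_iff using \<rho> \<sigma> by blast+
    ultimately show ?thesis
      by (intro ideal_generated_base UnI2) blast
  qed

  \<comment> \<open>Monomials that annihilate \<open>f\<close>\<close>
  show "Poly_Mapping.single t 1 \<in> ideal_generated ?G"
    if "\<And>w. Poly_Mapping.lookup f (w + t) = 0" for t
  proof -
    define \<beta> where "\<beta> j = Poly_Mapping.lookup t (Inr j)" for j
    have lookup_t: "Poly_Mapping.lookup s v \<le> Poly_Mapping.lookup t v"
      if "\<And>i. Poly_Mapping.lookup s (Inl i) \<le> Poly_Mapping.lookup t (Inl i)"
        "\<And>j. Poly_Mapping.lookup s (Inr j) \<le> \<beta> j" for s v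
      using that by (cases v) (auto simp: \<beta>_def)
    \<comment> \<open>If the x-part of \<open>t\<close> divides that of term \<open>r\<close>, the
      u-part cannot divide \<open>e r\<close>: otherwise \<open>t\<close> would divide term
      \<open>r\<close>, whose coefficient 1 would survive the contraction.\<close>
    have not_le: "\<not> \<beta> \<le> e r" if "\<And>i. Poly_Mapping.lookup t (Inl i) \<le> (if i = r then d\<^sub>1 else 0)" for r
    proof
      assume "\<beta> \<le> e r"
      then have "(xexp r d\<^sub>1 + uexp (e r) - t) + t = xexp r d\<^sub>1 + uexp (e r)"
        using that by (auto simp: expo_eq_iff lookup_add lookup_minus \<beta>_def le_fun_def)
      then have "Poly_Mapping.lookup f (xexp r d\<^sub>1 + uexp (e r)) = 0"
        using \<open>\<And>w. Poly_Mapping.lookup f (w + t) = 0\<close> by metis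
      with lookup_CW_Nagata_eq_1[OF f assms(1)] show False by simp
    qed
    \<comment> \<open>Each case leads to a generator dividing \<open>t\<close>. The last two retain
      the bound on \<open>udeg \<beta>\<close> because the generators from minimal missing elements
      have degree at most \<open>d\<^sub>2\<close>.\<close>
    consider (two) i j where "i \<noteq> j" "Poly_Mapping.lookup t (Inl i) \<ge> 1" "Poly_Mapping.lookup t (Inl j) \<ge> 1"
      | (power) k where "Poly_Mapping.lookup t (Inl k) \<ge> d\<^sub>1 + 1"
      | (degree) "udeg \<beta> \<ge> d\<^sub>2 + 1"
      | (none) "udeg \<beta> \<le> d\<^sub>2" "\<And>i. Poly_Mapping.lookup t (Inl i) = 0"
      | (one) r where "udeg \<beta> \<le> d\<^sub>2" "Poly_Mapping.lookup t (Inl r) \<ge> 1"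
          "\<And>i. Poly_Mapping.lookup t (Inl i) \<le> (if i = r then d\<^sub>1 else 0)"
    proof (cases "\<forall>i. Poly_Mapping.lookup t (Inl i) = 0")
      case True
      then show ?thesis using degree none by (cases "udeg \<beta> \<ge> d\<^sub>2 + 1") auto
    next
      case False
      then obtain r where r: "Poly_Mapping.lookup t (Inl r) \<noteq> 0" by blast
      show ?thesis
      proof (cases "\<exists>i. i \<noteq> r \<and> Poly_Mapping.lookup t (Inl i) \<noteq> 0")
        case True
        then obtain i where "i \<noteq> r" "Poly_Mapping.lookup t (Inl i) \<noteq> 0" by blast
        with r show ?thesis by (intro two[of i r]) simp_all
      next
        case others: False
        show ?thesis
        proof (cases "udeg \<beta> \<ge> d\<^sub>2 + 1 \<or> Poly_Mapping.lookup t (Inl r) \<ge> d\<^sub>1 + 1")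
          case True
          then show ?thesis using degree power by blast
        next
          case False
          then show ?thesis using r others by (intro one[of r]) auto
        qed
      qed
    qed
    then show ?thesis
    proof cases
      case two
      then show ?thesis
        by (intro single_mono_ideal_generated[OF G1[of i j] lookup_t]) (auto simp: lookup)
    next
      case power
      then show ?thesis
        by (intro single_mono_ideal_generated[OF G1'[of k] lookup_t]) auto
    next
      case degree
      then obtain \<alpha> where "\<alpha> \<le> \<beta>" "udeg \<alpha> = d\<^sub>2 + 1" by (rule exists_divisor_of_degree)
      then show ?thesis
        by (intro single_mono_ideal_generated[OF G2[of \<alpha>] lookup_t]) (auto simp: le_fun_def)
    next
      case none
      \<comment> \<open>Without x-variables in \<open>t\<close>, the assumption of
        \<open>not_le\<close> holds for every \<open>r\<close>, so \<open>\<beta>\<close> divides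
        none of the monomials.\<close>
      then have "\<not> CW_X \<beta> \<subseteq> CW_Delta e"
        using not_le by (simp add: CW_X_subset_CW_Delta_iff)
      then obtain s where s: "s \<le> \<beta>" "minimal_not_contained (CW_X s) (CW_Delta e)"
        by (rule exists_minimal_not_contained)
      moreover have "udeg s \<le> d\<^sub>2" using udeg_mono[OF s(1)] none by simp
      ultimately show ?thesis
        by (intro single_mono_ideal_generated[OF G3[of s] lookup_t]) (auto simp: le_fun_def)
    next
      case one
      \<comment> \<open>With the x-variable of index \<open>r\<close> present, only divisibility
        into \<open>e r\<close> is excluded; that variable is the extra factor of the generator in
        \<open>G5\<close>.\<close>
      then have "\<not> CW_X \<beta> \<subseteq> CW_X (e r)"
        using not_le by (simp add: CW_X_subset_iff)
      then obtain s where s: "s \<le> \<beta>" "minimal_not_contained (CW_X s) (CW_X (e r))"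
        by (rule exists_minimal_not_contained)
      moreover have "udeg s \<le> d\<^sub>2" using udeg_mono[OF s(1)] one by simp
      ultimately show ?thesis
        using one(2)
        by (intro single_mono_ideal_generated[OF G5[of s r] lookup_t]) (auto simp: le_fun_def lookup)
    qed
  qed

  \<comment> \<open>Pairs of monomials contributing to the same coefficient\<close>
  show "Poly_Mapping.single t 1 - Poly_Mapping.single s 1 \<in> ideal_generated ?G"
    if "s \<noteq> t" and fs: "Poly_Mapping.lookup f (w + s) \<noteq> 0"
      and ft: "Poly_Mapping.lookup f (w + t) \<noteq> 0" for s t w
  proof -
    obtain p where p: "w + s = xexp p d\<^sub>1 + uexp (e p)"
      using lookup_CW_Nagata_nonzeroE[OF f fs] .
    obtain r where r: "w + t = xexp r d\<^sub>1 + uexp (e r)"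
      using lookup_CW_Nagata_nonzeroE[OF f ft] .
    have "p \<noteq> r" using p r \<open>s \<noteq> t\<close> by (metis add_left_cancel)
    have x: "Poly_Mapping.lookup w (Inl i) + Poly_Mapping.lookup s (Inl i) = (if i = p then d\<^sub>1 else 0)"
      "Poly_Mapping.lookup w (Inl i) + Poly_Mapping.lookup t (Inl i) = (if i = r then d\<^sub>1 else 0)" for i
      using arg_cong[OF p, of "\<lambda>t. Poly_Mapping.lookup t (Inl i)"]
        arg_cong[OF r, of "\<lambda>t. Poly_Mapping.lookup t (Inl i)"] by (simp_all add: lookup_add)
    have u: "Poly_Mapping.lookup w (Inr j) + Poly_Mapping.lookup s (Inr j) = e p j"
      "Poly_Mapping.lookup w (Inr j) + Poly_Mapping.lookup t (Inr j) = e r j" for j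
      using arg_cong[OF p, of "\<lambda>t. Poly_Mapping.lookup t (Inr j)"]
        arg_cong[OF r, of "\<lambda>t. Poly_Mapping.lookup t (Inr j)"] by (simp_all add: lookup_add)
    have u': "Poly_Mapping.lookup s (Inr j) = e p j - Poly_Mapping.lookup w (Inr j)"
      "Poly_Mapping.lookup t (Inr j) = e r j - Poly_Mapping.lookup w (Inr j)" for j
      by (simp_all flip: u)
    \<comment> \<open>The x-part of \<open>w\<close> divides powers of two different variables,
      hence is trivial; so \<open>t\<close> and \<open>s\<close> carry the full powers of exponent
      \<open>d\<^sub>1\<close>.\<close>
    have w: "Poly_Mapping.lookup w (Inl i) = 0" for i
      using x[of i] \<open>p \<noteq> r\<close> by (auto split: if_splits)
    \<comment> \<open>The u-part of \<open>w\<close> divides both monomials, hence their gcd. So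
      \<open>uexp \<gamma> - w\<close> is an exact difference, and it is the common factor that
      takes the two monomials of the binomial to \<open>t\<close> and \<open>s\<close>.\<close>
    define \<gamma> where "\<gamma> = inf (e r) (e p)"
    have le: "Poly_Mapping.lookup w (Inr j) \<le> \<gamma> j" for j
      using u(1)[of j] u(2)[of j] by (simp add: \<gamma>_def)
    have \<gamma>: "\<gamma> j \<le> e r j" "\<gamma> j \<le> e p j" for j by (simp_all add: \<gamma>_def)
    have t: "t = (uexp \<gamma> - w) + (xexp r d\<^sub>1 + uexp (e r - \<gamma>))"
      using x(2) w u'(2) le \<gamma>(1) by (auto simp: expo_eq_iff lookup_add lookup_minus)
    have s: "s = (uexp \<gamma> - w) + (xexp p d\<^sub>1 + uexp (e p - \<gamma>))"
      using x(1) w u'(1) le \<gamma>(2) by (auto simp: expo_eq_iff lookup_add lookup_minus)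
    have "Poly_Mapping.single t 1 - Poly_Mapping.single s 1 =
      Poly_Mapping.single (uexp \<gamma> - w) 1 *
        (xvar r ^ d\<^sub>1 * umon (e r - \<gamma>) - xvar p ^ d\<^sub>1 * umon (e p - \<gamma>) :: ('n, 'm, 'k) S_poly)"
      by (subst t, subst s)
        (simp add: xvar_power umon_eq_single mult_single right_diff_distrib)
    then show ?thesis
      using ideal_generated_mult[OF G6[of r p]] by (simp only: \<gamma>_def)
  qed
qed

end
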